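(* Let $m,n\ge 1$ be integers. The $mn\times mn$ real matrix $A(m,n)$ is singular if and only if at least one of the following holds: 1. $m\equiv 2 \pmod 3$ and $n$ is odd; 2. $m$ is odd and $n\equiv 2\pmod 3$; 3. $m\equiv 4\pmod 5$ and $n\equiv 4\pmod 5$.
   Context: For an integer $n\ge 1$, let $I_n$ be the $n\times n$ identity matrix and let $T_n$ be the $n\times n$ tridiagonal matrix whose entries on the main diagonal, the first superdiagonal and the first subdiagonal are all equal to $1$, all other entries being $0$ (so $T_1=[1]$). For integers $m,n\ge1$, $A(m,n)$ is the $mn\times mn$ block tridiagonal matrix with $m\times m$ blocks of size $n\times n$, whose diagonal blocks are all $T_n$, whose blocks immediately above and below the diagonal are all $I_n$, and whose other blocks are zero. Equivalently, $A(m,n)=I_m\otimes T_n+T_m\otimes I_n-I_{mn}$, where $\otimes$ is the Kronecker product. (It is the matrix of the Lights Out game on an $m$ by $n$ grid.) The entries $0,1$ are regarded as real numbers, so "singular" means that the determinant of $A(m,n)$, computed over $\mathbb{R}$, is zero. *)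

theory Defs
  imports Complex_Main "Jordan_Normal_Form.Determinant"
begin

definition T_mat :: "nat \<Rightarrow> real mat" where
  "T_mat n = mat n n (\<lambda>(i, j). if i = j \<or> j = Suc i \<or> i = Suc j then 1 else 0)"

definition lights_out_block :: "nat \<Rightarrow> nat \<Rightarrow> nat \<Rightarrow> real mat" where
  "lights_out_block n p q =
     (if p = q then T_mat n
      else if q = Suc p \<or> p = Suc q then 1\<^sub>m n
      else 0\<^sub>m n n)"

text \<open>Rows and columns are indexed from 0, so entry \<open>(i, j)\<close> lies in block
  \<open>(i div n, j div n)\<close>, at position \<open>(i mod n, j mod n)\<close> of that block.\<close>

definition lights_out_mat :: "nat \<Rightarrow> nat \<Rightarrow> real mat" where
  "lights_out_mat m n = mat (m * n) (m * n)
     (\<lambda>(i, j). lights_out_block n (i div n) (j div n) $$ (i mod n, j mod n))"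

definition kronecker :: "real mat \<Rightarrow> real mat \<Rightarrow> real mat" where
  "kronecker A B = mat (dim_row A * dim_row B) (dim_col A * dim_col B)
     (\<lambda>(i, j). A $$ (i div dim_row B, j div dim_col B) * B $$ (i mod dim_row B, j mod dim_col B))"

lemma lights_out_mat_kronecker:
  "lights_out_mat m n = kronecker (1\<^sub>m m) (T_mat n) + kronecker (T_mat m) (1\<^sub>m n) - 1\<^sub>m (m * n)"
proof (rule eq_matI)
  fix i j
  assume "i < dim_row (kronecker (1\<^sub>m m) (T_mat n) + kronecker (T_mat m) (1\<^sub>m n) - 1\<^sub>m (m * n))"
    and "j < dim_col (kronecker (1\<^sub>m m) (T_mat n) + kronecker (T_mat m) (1\<^sub>m n) - 1\<^sub>m (m * n))"
  then have ij: "i < m * n" "j < m * n" by auto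
  then have "n > 0" by (cases n) auto
  have "i = j \<longleftrightarrow> i div n = j div n \<and> i mod n = j mod n"
    by (metis div_mult_mod_eq)
  then show "lights_out_mat m n $$ (i, j) =
      (kronecker (1\<^sub>m m) (T_mat n) + kronecker (T_mat m) (1\<^sub>m n) - 1\<^sub>m (m * n)) $$ (i, j)"
    using ij \<open>n > 0\<close> less_mult_imp_div_less[OF ij(1)] less_mult_imp_div_less[OF ij(2)]
    by (simp add: lights_out_mat_def lights_out_block_def kronecker_def T_mat_def)
qed (simp_all add: lights_out_mat_def kronecker_def T_mat_def)

end

(* The vectors with entries sin (i j pi / (n + 1)) diagonalise T_n, so their Kronecker products
   diagonalise A(m, n), whose eigenvalues are 1 + u + v with u = 2 cos (a pi / (m + 1)),
   v = 2 cos (b pi / (n + 1)), 0 < a <= m, 0 < b <= n.  If u + v = -1, put w = u v.  The conjugates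
   of the algebraic integer w are again products of two reals in [-2, 2] with sum -1, hence lie in
   [-2, 1/4], where w (w + 1) (w + 2) has absolute value less than 1.  An algebraic integer all of
   whose conjugates are that small is zero, so w is 0, -1 or -2.  These give cos 90 + cos 120
   (degrees), the pentagon cos 72 + cos 144, and the impossible u = 1, v = -2. *)
theory Submission
  imports Defs "Jordan_Normal_Form.Char_Poly"
begin

section \<open>Interpolation and conjugates of roots of unity\<close>

text \<open>By Lagrange interpolation, such a \<open>p\<close> is the combination of fixed basis
  polynomials \<open>L z\<close> with weights \<open>poly p z\<close>, so \<open>B\<close> depends
  on \<open>A\<close> alone. This turns small values into small coefficients.\<close>

lemma coeff_bounded_by_values:
  fixes A :: "complex set"
  assumes "finite A"
  obtains B where "B \<ge> 0"
    "\<And>p i. degree p < card A \<Longrightarrow> norm (coeff p i) \<le> B * (\<Sum>z\<in>A. norm (poly p z))"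
proof -
  define L where "L z = smult (1 / (\<Prod>w\<in>A - {z}. z - w)) (\<Prod>w\<in>A - {z}. [:- w, 1:])" for z
  define b where "b z = (\<Sum>j\<le>degree (L z). norm (coeff (L z) j))" for z
  define B where "B = (\<Sum>z\<in>A. b z)"
  have b_nonneg: "b z \<ge> 0" for z
    by (simp add: b_def sum_nonneg)
  have b_le: "b z \<le> B" if "z \<in> A" for z
    unfolding B_def by (rule member_le_sum) (use that assms b_nonneg in auto)
  have coeff_L: "norm (coeff (L z) i) \<le> b z" for z i
  proof (cases "i \<le> degree (L z)")
    case True
    then show ?thesis
      unfolding b_def by (intro member_le_sum) auto
  next
    case False
    then show ?thesis
      using b_nonneg[of z] by (simp add: coeff_eq_0)
  qed
  have poly_L: "poly (L z) w = (if w = z then 1 else 0)" if "z \<in> A" "w \<in> A" for z w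
  proof (cases "w = z")
    case True
    have "(\<Prod>w\<in>A - {z}. z - w) \<noteq> 0"
      using assms by simp
    then show ?thesis
      using True by (simp add: L_def poly_prod)
  next
    case False
    then have "(\<Prod>x\<in>A - {z}. w - x) = 0"
      using that assms by (auto simp: prod_zero_iff)
    then show ?thesis
      using False by (simp add: L_def poly_prod)
  qed
  have degree_L: "degree (L z) < card A" if "z \<in> A" for z
  proof -
    have "degree (L z) \<le> degree (\<Prod>w\<in>A - {z}. [:- w, 1:])"
      unfolding L_def by (rule degree_smult_le)
    also have "\<dots> = card (A - {z})"
      by (subst degree_prod_eq_sum_degree) auto
    also have "\<dots> < card A"
      using that assms by (intro psubset_card_mono) auto
    finally show ?thesis .
  qed
  have "norm (coeff p i) \<le> B * (\<Sum>z\<in>A. norm (poly p z))" if p: "degree p < card A" for p i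
  proof -
    have "p = (\<Sum>z\<in>A. smult (poly p z) (L z))"
    proof (rule poly_eqI_degree[OF _ p])
      fix w assume w: "w \<in> A"
      have "poly (\<Sum>z\<in>A. smult (poly p z) (L z)) w = (\<Sum>z\<in>A. if w = z then poly p z else 0)"
        unfolding poly_sum by (rule sum.cong) (use w poly_L in auto)
      then show "poly p w = poly (\<Sum>z\<in>A. smult (poly p z) (L z)) w"
        using w assms by simp
    next
      show "degree (\<Sum>z\<in>A. smult (poly p z) (L z)) < card A"
      proof (rule degree_sum_less)
        show "0 < card A" using p by simp
        show "degree (smult (poly p z) (L z)) < card A" if "z \<in> A" for z
          using degree_L[OF that] degree_smult_le[of "poly p z" "L z"] by linarith
      qed
    qed
    then have "coeff p i = (\<Sum>z\<in>A. poly p z * coeff (L z) i)"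
      by (metis (no_types, lifting) coeff_smult coeff_sum sum.cong)
    then have "norm (coeff p i) \<le> (\<Sum>z\<in>A. norm (poly p z * coeff (L z) i))"
      by (simp add: sum_norm_le)
    also have "\<dots> \<le> (\<Sum>z\<in>A. norm (poly p z) * B)"
      unfolding norm_mult
      by (intro sum_mono mult_left_mono order_trans[OF coeff_L b_le]) auto
    finally show ?thesis
      by (simp add: sum_distrib_left mult.commute)
  qed
  moreover have "B \<ge> 0"
    using b_nonneg by (simp add: B_def sum_nonneg)
  ultimately show ?thesis
    using that by blast
qed

abbreviation ipoly :: "int poly \<Rightarrow> complex \<Rightarrow> complex" where
  "ipoly p z \<equiv> poly (map_poly of_int p) z"

text \<open>Pseudo-division over the integers shows divisibility only up to a constant factor
  \<open>c\<close>, which is harmless for roots.\<close>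

lemma ipoly_eq_0_if_smult_multiple:
  assumes "smult c p = f * q" "c \<noteq> 0" "ipoly f z = 0"
  shows "ipoly p z = 0"
proof -
  have "of_int c * ipoly p z = ipoly (smult c p) z"
    by (simp add: of_int_hom.map_poly_hom_smult)
  also have "\<dots> = ipoly f z * ipoly q z"
    by (simp add: assms(1) of_int_poly_hom.hom_mult)
  finally show ?thesis
    using assms(2,3) by simp
qed

definition unity_poly :: "nat \<Rightarrow> int poly" where
  "unity_poly N = monom 1 N - 1"

lemma ipoly_unity_poly: "ipoly (unity_poly N) z = z ^ N - 1"
  by (simp add: unity_poly_def of_int_poly_hom.hom_minus of_int_hom.map_poly_hom_monom poly_monom)

lemma unity_poly_properties:
  assumes "N > 0"
  shows "degree (unity_poly N) = N" "lead_coeff (unity_poly N) = 1" "unity_poly N \<noteq> 0"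
proof -
  have c: "coeff (unity_poly N) N = 1"
    using assms by (simp add: unity_poly_def)
  have "degree (unity_poly N) \<le> N"
    unfolding unity_poly_def by (rule degree_diff_le) (auto simp: degree_monom_le)
  moreover have "N \<le> degree (unity_poly N)"
    using c by (intro le_degree) simp
  ultimately show d: "degree (unity_poly N) = N" by simp
  show "lead_coeff (unity_poly N) = 1" using c d by simp
  show "unity_poly N \<noteq> 0" using c by auto
qed

lemma norm_root_of_unity:
  fixes z :: "'a::real_normed_div_algebra"
  assumes "K > 0" "z ^ K = 1"
  shows "norm z = 1"
proof -
  have "norm z ^ K = 1 ^ K"
    using assms(2) by (metis norm_one norm_power power_one)
  then show ?thesis
    using assms(1) by (intro power_eq_imp_eq_base[of "norm z" K 1]) simp_all
qed

lemma mult_cnj_eq_1: "norm z = 1 \<Longrightarrow> z * cnj z = 1"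
  using complex_norm_square[of z] by simp

text \<open>An algebraic integer whose conjugates all lie inside the open unit disc is zero. The
  conjugates of \<open>\<zeta>\<close> are \<open>N\<close>-th roots of unity and roots of
  \<open>F\<close>, so \<open>small\<close> applies to all of them. Powers of \<open>G\<close> then
  reduce to integer polynomials with coefficients below 1 in absolute value, that is, to
  zero.\<close>

lemma root_of_unity_conjugate_bound:
  fixes \<zeta> :: complex and F G :: "int poly"
  assumes N: "N > 0" and \<zeta>: "\<zeta> ^ N = 1" and F: "ipoly F \<zeta> = 0"
    and small: "\<And>\<rho>. \<rho> ^ N = 1 \<Longrightarrow> ipoly F \<rho> = 0 \<Longrightarrow> norm (ipoly G \<rho>) < 1"
  shows "ipoly G \<zeta> = 0"
proof -
  define ann where "ann p \<longleftrightarrow> p \<noteq> 0 \<and> ipoly p \<zeta> = 0" for p :: "int poly"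
  have ann_unity: "ann (unity_poly N)"
    using N \<zeta> by (simp add: ann_def ipoly_unity_poly unity_poly_properties)
  define \<mu> where "\<mu> = arg_min degree ann"
  have \<mu>: "\<mu> \<noteq> 0" "ipoly \<mu> \<zeta> = 0"
    using arg_min_natI[of ann, OF ann_unity] by (auto simp: \<mu>_def ann_def)
  have \<mu>_min: "degree \<mu> \<le> degree p" if "p \<noteq> 0" "ipoly p \<zeta> = 0" for p
    unfolding \<mu>_def by (rule arg_min_nat_le) (use that in \<open>simp add: ann_def\<close>)
  define c where "c = lead_coeff \<mu>"
  have c: "c \<noteq> 0" using \<mu> by (simp add: c_def)
  define d where "d = degree \<mu>"
  have d: "d > 0"
  proof (rule ccontr)
    assume "\<not> d > 0"
    then obtain a where "\<mu> = [:a:]" by (metis d_def degree_eq_zeroE not_gr_zero)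
    then show False using \<mu> by (simp add: map_poly_pCons)
  qed
  have vanish: "\<exists>q. smult (c ^ (Suc (degree p) - d)) p = \<mu> * q" if "ipoly p \<zeta> = 0" for p
  proof -
    \<comment> \<open>The leading coefficient \<open>c\<close> of \<open>\<mu>\<close> is not known
      to be 1, hence pseudo-division. The remainder vanishes at \<open>\<zeta>\<close> and has
      smaller degree than \<open>\<mu>\<close>, so minimality makes it zero.\<close>
    obtain q r where qr: "pseudo_divmod p \<mu> = (q, r)" by fastforce
    note 1 = pseudo_divmod(1)[OF \<mu>(1) qr, folded c_def d_def]
      and 2 = pseudo_divmod(2)[OF \<mu>(1) qr, folded d_def]
    have "r = smult (c ^ (Suc (degree p) - d)) p - \<mu> * q" using 1 by simp
    then have "ipoly r \<zeta> = 0"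
      using that \<mu> by (simp add: of_int_poly_hom.hom_minus of_int_poly_hom.hom_mult
          of_int_hom.map_poly_hom_smult)
    then have "r = 0"
      using 2 \<mu>_min[of r] by (cases "r = 0") (auto simp: d_def)
    then show ?thesis using 1 by auto
  qed
  \<comment> \<open>\<open>S\<close> consists of the conjugates of \<open>\<zeta>\<close>.\<close>
  define S where "S = {\<rho>. ipoly \<mu> \<rho> = 0}"
  have vanish_S: "ipoly p \<rho> = 0" if "ipoly p \<zeta> = 0" "\<rho> \<in> S" for p \<rho>
  proof -
    obtain q where "smult (c ^ (Suc (degree p) - d)) p = \<mu> * q" using vanish[OF \<open>ipoly p \<zeta> = 0\<close>] ..
    then show ?thesis
      by (rule ipoly_eq_0_if_smult_multiple) (use c that in \<open>auto simp: S_def\<close>)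
  qed
  have unity_S: "\<rho> ^ N = 1" if "\<rho> \<in> S" for \<rho>
    using vanish_S[OF _ that, of "unity_poly N"] \<zeta> by (simp add: ipoly_unity_poly)
  have "map_poly of_int \<mu> \<noteq> (0 :: complex poly)"
    using \<mu> by simp
  then have finS: "finite S"
    unfolding S_def by (rule poly_roots_finite)
  \<comment> \<open>a double root of \<open>\<mu>\<close> would be a double root of \<open>X^N - 1\<close>\<close>
  have "rsquarefree (map_poly of_int \<mu> :: complex poly)"
    unfolding rsquarefree_roots
  proof (intro allI notI, elim conjE)
    fix \<rho> :: complex
    assume 0: "ipoly \<mu> \<rho> = 0" "poly (pderiv (map_poly of_int \<mu>)) \<rho> = 0"
    obtain e q where e: "smult (c ^ e) (unity_poly N) = \<mu> * q"
      using vanish[of "unity_poly N"] \<zeta> by (auto simp: ipoly_unity_poly)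
    let ?U = "monom 1 N - 1 :: complex poly"
    have "smult (of_int (c ^ e)) ?U = map_poly of_int (\<mu> * q)"
      unfolding e[symmetric] of_int_hom.map_poly_hom_smult unity_poly_def of_int_poly_hom.hom_minus
        of_int_hom.map_poly_hom_monom by simp
    then have "pderiv (smult (of_int (c ^ e)) ?U) =
        pderiv (map_poly of_int \<mu> * map_poly of_int q)"
      by (simp only: of_int_poly_hom.hom_mult)
    then have "poly (pderiv (smult (of_int (c ^ e)) ?U)) \<rho> = 0"
      using 0 by (simp only: pderiv_mult poly_add poly_mult) simp
    then have "of_int c ^ e * (of_nat N * \<rho> ^ (N - 1)) = 0"
      by (simp add: pderiv_smult pderiv_diff pderiv_monom poly_monom pderiv_1)
    then have "\<rho> = 0" using c N by auto
    moreover have "\<rho> ^ N = 1" using 0 by (intro unity_S) (simp add: S_def)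
    ultimately show False using N by (simp add: power_0_left)
  qed
  then have card_S: "card S = d"
    unfolding S_def d_def using \<mu> by (subst (asm) rsquarefree_card_degree) auto
  \<comment> \<open>on \<open>S\<close> every integer polynomial agrees, up to the fixed factor \<open>c ^ N\<close>,
    with an integer polynomial of degree less than \<open>card S\<close>\<close>
  have reduce: "\<exists>r. degree r < d \<and> (\<forall>\<rho>\<in>S. of_int (c ^ N) * ipoly p \<rho> = ipoly r \<rho>)" for p
  proof -
    \<comment> \<open>Dividing first by the monic \<open>X^N - 1\<close> costs no scaling and brings
      the degree below \<open>N\<close>, whatever the degree of \<open>p\<close>. The later power of
      \<open>c\<close> is therefore bounded independently of \<open>p\<close>.\<close>
    obtain q0 r0 where qr0: "pseudo_divmod p (unity_poly N) = (q0, r0)" by fastforce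
    note U = unity_poly_properties[OF N]
    have "p = unity_poly N * q0 + r0"
      using pseudo_divmod(1)[OF U(3) qr0] U(2) by simp
    then have r0: "ipoly p \<rho> = ipoly r0 \<rho>" if "\<rho> \<in> S" for \<rho>
      using unity_S[OF that]
      by (simp add: of_int_poly_hom.hom_add of_int_poly_hom.hom_mult ipoly_unity_poly)
    have deg_r0: "degree r0 < N"
      using pseudo_divmod(2)[OF U(3) qr0] U(1) N by auto
    obtain q r where qr: "pseudo_divmod r0 \<mu> = (q, r)" by fastforce
    define e where "e = Suc (degree r0) - d"
    have r: "smult (c ^ e) r0 = \<mu> * q + r"
      using pseudo_divmod(1)[OF \<mu>(1) qr] by (simp add: e_def c_def d_def)
    have deg_r: "degree r < d"
      using pseudo_divmod(2)[OF \<mu>(1) qr] d by (auto simp: d_def)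
    have "of_int (c ^ N) * ipoly p \<rho> = ipoly (smult (c ^ (N - e)) r) \<rho>" if "\<rho> \<in> S" for \<rho>
    proof -
      have "of_int (c ^ e) * ipoly r0 \<rho> = ipoly (smult (c ^ e) r0) \<rho>"
        by (simp add: of_int_hom.map_poly_hom_smult)
      also have "\<dots> = ipoly r \<rho>"
        unfolding r using that
        by (simp add: of_int_poly_hom.hom_add of_int_poly_hom.hom_mult S_def)
      finally have *: "of_int (c ^ e) * ipoly r0 \<rho> = ipoly r \<rho>" .
      \<comment> \<open>Since \<open>degree r0 < N\<close>, the exponent \<open>e\<close> is at most
        \<open>N\<close>; the missing power of \<open>c\<close> makes the factor the same for every
        \<open>p\<close>.\<close>
      have "c ^ N = c ^ (N - e) * c ^ e"
        using deg_r0 by (simp add: e_def flip: power_add)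
      then have "of_int (c ^ N) * ipoly p \<rho> = of_int (c ^ (N - e)) * (of_int (c ^ e) * ipoly r0 \<rho>)"
        using r0[OF that] by simp
      also have "\<dots> = ipoly (smult (c ^ (N - e)) r) \<rho>"
        by (simp only: *) (simp add: of_int_hom.map_poly_hom_smult)
      finally show ?thesis .
    qed
    moreover have "degree (smult (c ^ (N - e)) r) < d"
      using deg_r degree_smult_le[of "c ^ (N - e)" r] by linarith
    ultimately show ?thesis by blast
  qed
  \<comment> \<open>a high power of \<open>G\<close> is so small on \<open>S\<close> that its reduction has integer coefficients of
    absolute value less than 1\<close>
  obtain B where B: "B \<ge> 0"
    "\<And>p i. degree p < card S \<Longrightarrow> norm (coeff p i) \<le> B * (\<Sum>z\<in>S. norm (poly p z))"
    using coeff_bounded_by_values[OF finS] by blast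
  have "(\<lambda>n. B * (\<Sum>\<rho>\<in>S. norm (of_int (c ^ N) :: complex) * norm (ipoly G \<rho>) ^ n)) \<longlonglongrightarrow>
      B * (\<Sum>\<rho>\<in>S. norm (of_int (c ^ N) :: complex) * 0)"
    by (intro tendsto_intros LIMSEQ_realpow_zero) (use small unity_S vanish_S[OF F] in auto)
  then have "eventually (\<lambda>n. B * (\<Sum>\<rho>\<in>S. norm (of_int (c ^ N) :: complex) * norm (ipoly G \<rho>) ^ n) < 1)
      sequentially"
    by (rule order_tendstoD) simp
  then obtain n where n: "B * (\<Sum>\<rho>\<in>S. norm (of_int (c ^ N) :: complex) * norm (ipoly G \<rho>) ^ n) < 1"
    by (meson eventually_sequentially le_refl)
  obtain r where r: "degree r < d" "\<And>\<rho>. \<rho> \<in> S \<Longrightarrow> of_int (c ^ N) * ipoly (G ^ n) \<rho> = ipoly r \<rho>"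
    using reduce[of "G ^ n"] by blast
  have "coeff r i = 0" for i
  proof -
    have "norm (of_int (coeff r i) :: complex) = norm (coeff (map_poly of_int r :: complex poly) i)"
      by simp
    also have "\<dots> \<le> B * (\<Sum>\<rho>\<in>S. norm (ipoly r \<rho>))"
      by (rule B(2)) (use r card_S in simp)
    also have "(\<Sum>\<rho>\<in>S. norm (ipoly r \<rho>)) =
        (\<Sum>\<rho>\<in>S. norm (of_int (c ^ N) :: complex) * norm (ipoly G \<rho>) ^ n)"
      by (rule sum.cong)
        (auto simp flip: r(2) simp: of_int_poly_hom.hom_power norm_mult norm_power)
    also note n
    finally show ?thesis by simp
  qed
  then have "r = 0" by (simp add: poly_eq_iff)
  then have "of_int (c ^ N) * ipoly (G ^ n) \<zeta> = 0"
    using r(2)[of \<zeta>] \<mu> by (simp add: S_def)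
  \<comment> \<open>The exponent \<open>n\<close> may be 0, but then the equation would say that a
    power of \<open>c\<close> vanishes.\<close>
  then show ?thesis
    using c by (auto simp: of_int_poly_hom.hom_power)
qed

section \<open>Cosines of rational multiples of pi\<close>

lemma ipoly_simps:
  "ipoly (p + q) z = ipoly p z + ipoly q z"
  "ipoly (p * q) z = ipoly p z * ipoly q z"
  "ipoly 1 z = 1"
  "ipoly 2 z = 2"
  "ipoly (monom 1 k) z = z ^ k"
  by (simp_all only: of_int_poly_hom.hom_add of_int_poly_hom.hom_mult of_int_poly_hom.hom_one
      of_int_poly_hom.hom_numeral of_int_hom.map_poly_hom_monom of_int_1 poly_add poly_mult poly_1
      poly_numeral poly_monom mult_1)

text \<open>The \<open>k\<close>-th power of a \<open>K\<close>-th root of unity has inverse the power with exponent \<open>k * (K - 1)\<close>.\<close>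

definition double_Re_poly :: "nat \<Rightarrow> nat \<Rightarrow> int poly" where
  "double_Re_poly K k = monom 1 k + monom 1 (k * (K - 1))"

text \<open>On the unit circle the inverse is the complex conjugate. One integer polynomial serves
  all \<open>K\<close>-th roots of unity, so the conjugates of a doubled cosine are again real and
  in [-2, 2].\<close>

lemma ipoly_double_Re_poly:
  assumes "K > 0" "\<rho> ^ K = 1"
  shows "ipoly (double_Re_poly K k) \<rho> = complex_of_real (2 * Re (\<rho> ^ k))"
proof -
  have 1: "norm (\<rho> ^ k) = 1"
    using norm_root_of_unity[OF assms] by (simp add: norm_power)
  have "k + k * (K - 1) = K * k"
    using assms(1) by (cases K) auto
  then have "\<rho> ^ k * \<rho> ^ (k * (K - 1)) = (\<rho> ^ K) ^ k"
    by (simp only: flip: power_add power_mult)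
  also have "\<dots> = \<rho> ^ k * cnj (\<rho> ^ k)"
    unfolding assms(2) mult_cnj_eq_1[OF 1] by (rule power_one)
  finally have "\<rho> ^ (k * (K - 1)) = cnj (\<rho> ^ k)"
    by (rule mult_left_cancel[THEN iffD1, rotated]) (use norm_root_of_unity[OF assms] in auto)
  then have "ipoly (double_Re_poly K k) \<rho> = \<rho> ^ k + cnj (\<rho> ^ k)"
    by (simp only: double_Re_poly_def ipoly_simps)
  then show ?thesis
    using complex_add_cnj[of "\<rho> ^ k"] by (rule trans)
qed

lemma product_cubic_bound:
  fixes u v :: real
  assumes "u + v = -1" "\<bar>u\<bar> \<le> 2" "\<bar>v\<bar> \<le> 2"
  shows "\<bar>(u * v) * (u * v + 1) * (u * v + 2)\<bar> < 1"
proof -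
  \<comment> \<open>Centring turns the cubic into \<open>t ^ 3 - t\<close>, with \<open>t\<close>
    between -1 and 5/4.\<close>
  define t where "t = u * v + 1"
  have v: "v = -1 - u" using assms(1) by simp
  have "5 / 4 - t = (u + 1 / 2)\<^sup>2"
    by (simp add: t_def v power2_eq_square algebra_simps)
  then have upper: "t \<le> 5 / 4" by (smt (verit) zero_le_power2)
  have "0 \<le> (1 - u) * (u + 2)"
    using assms by (intro mult_nonneg_nonneg) auto
  then have lower: "-1 \<le> t" by (simp add: t_def v algebra_simps)
  have "\<bar>t ^ 3 - t\<bar> < 1"
  proof (cases "t \<ge> 0")
    case True
    have "t * t\<^sup>2 \<le> t * (5 / 4)\<^sup>2"
      by (intro mult_left_mono power_mono upper True)
    then have "t ^ 3 \<le> t * (25 / 16)"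
      by (simp add: power3_eq_cube power2_eq_square)
    then have 1: "t ^ 3 - t < 1" using upper by linarith
    \<comment> \<open>One third of this inequality plus two thirds of \<open>0 \<le> t ^ 3\<close>
      gives \<open>t ^ 3 - t \<ge> - 2 / 3\<close>.\<close>
    have "0 \<le> (t + 2) * (t - 1)\<^sup>2" using True by simp
    then have "0 \<le> t ^ 3 - 3 * t + 2"
      by (simp add: power3_eq_cube power2_eq_square algebra_simps)
    moreover have "0 \<le> t ^ 3" using True by simp
    ultimately have "- 1 < t ^ 3 - t" by linarith
    with 1 show ?thesis by simp
  next
    case False
    define s where "s = - t"
    have s: "0 < s" "s \<le> 1" using False lower by (auto simp: s_def)
    have "0 < s ^ 3" "s ^ 3 \<le> s"
      using s power_decreasing[of 1 3 s] by auto
    then have "\<bar>s ^ 3 - s\<bar> < 1" using s by linarith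
    then show ?thesis by (simp add: s_def)
  qed
  moreover have "(u * v) * (u * v + 1) * (u * v + 2) = t ^ 3 - t"
    by (simp add: t_def power3_eq_cube algebra_simps)
  ultimately show ?thesis by simp
qed

text \<open>Both cosines are integer polynomials in one root of unity \<open>\<zeta>\<close>. The
  relation \<open>1 + EA + EB\<close> passes to its conjugates, where
  \<open>product_cubic_bound\<close> makes \<open>G\<close> small, so \<open>G\<close> vanishes at
  \<open>\<zeta>\<close>.\<close>

lemma root_of_unity_cosine_product:
  assumes M: "M > 0" and N: "N > 0"
    and eq: "2 * cos (real a * pi / real M) + 2 * cos (real b * pi / real N) = -1"
  defines "w \<equiv> (2 * cos (real a * pi / real M)) * (2 * cos (real b * pi / real N))"
  shows "w = 0 \<or> w = -1 \<or> w = -2"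
proof -
  \<comment> \<open>The factor 2 is there because the angles are multiples of \<open>pi / M\<close>
    and \<open>pi / N\<close>, not of \<open>2 * pi / M\<close> and
    \<open>2 * pi / N\<close>.\<close>
  define K where "K = 2 * M * N"
  have K: "K > 0" using M N by (simp add: K_def)
  define \<zeta> where "\<zeta> = cis (2 * pi / real K)"
  have \<zeta>K: "\<zeta> ^ K = 1"
    using K by (simp add: \<zeta>_def Complex.DeMoivre)
  have \<zeta>a: "\<zeta> ^ (a * N) = cis (real a * pi / real M)"
    using M N by (simp add: \<zeta>_def Complex.DeMoivre K_def field_simps)
  have \<zeta>b: "\<zeta> ^ (b * M) = cis (real b * pi / real N)"
    using M N by (simp add: \<zeta>_def Complex.DeMoivre K_def field_simps)
  define EA where "EA = double_Re_poly K (a * N)"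
  define EB where "EB = double_Re_poly K (b * M)"
  define G where "G = (EA * EB) * (EA * EB + 1) * (EA * EB + 2)"
  have "ipoly G \<zeta> = 0"
  proof (rule root_of_unity_conjugate_bound[OF K \<zeta>K])
    have "ipoly (1 + EA + EB) \<zeta> = complex_of_real
        (1 + 2 * cos (real a * pi / real M) + 2 * cos (real b * pi / real N))"
      by (simp add: ipoly_simps EA_def EB_def ipoly_double_Re_poly[OF K \<zeta>K] \<zeta>a \<zeta>b
          del: of_real_mult)
    then show "ipoly (1 + EA + EB) \<zeta> = 0"
      using eq by (simp only: add.assoc) simp
  next
    fix \<rho> :: complex
    assume \<rho>: "\<rho> ^ K = 1" and F: "ipoly (1 + EA + EB) \<rho> = 0"
    define u v where "u = 2 * Re (\<rho> ^ (a * N))" and "v = 2 * Re (\<rho> ^ (b * M))"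
    have u: "ipoly EA \<rho> = complex_of_real u" and v: "ipoly EB \<rho> = complex_of_real v"
      unfolding EA_def EB_def u_def v_def by (rule ipoly_double_Re_poly[OF K \<rho>])+
    have "\<bar>u\<bar> \<le> 2" "\<bar>v\<bar> \<le> 2"
      using abs_Re_le_cmod[of "\<rho> ^ (a * N)"] abs_Re_le_cmod[of "\<rho> ^ (b * M)"]
      by (simp_all add: u_def v_def norm_power norm_root_of_unity[OF K \<rho>])
    moreover have "complex_of_real (1 + u + v) = 0"
      using F by (simp add: ipoly_simps u v)
    then have "u + v = -1"
      by (simp only: of_real_eq_0_iff)
    ultimately have "\<bar>(u * v) * (u * v + 1) * (u * v + 2)\<bar> < 1"
      by (intro product_cubic_bound)
    moreover have "ipoly G \<rho> = complex_of_real ((u * v) * (u * v + 1) * (u * v + 2))"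
      by (simp add: G_def ipoly_simps u v)
    ultimately show "norm (ipoly G \<rho>) < 1"
      by (simp only: norm_of_real)
  qed
  moreover have "ipoly EA \<zeta> * ipoly EB \<zeta> = complex_of_real w"
    by (simp add: EA_def EB_def ipoly_double_Re_poly[OF K \<zeta>K] \<zeta>a \<zeta>b w_def)
  then have "ipoly G \<zeta> = complex_of_real (w * (w + 1) * (w + 2))"
    by (simp add: G_def ipoly_simps)
  ultimately have "w * (w + 1) * (w + 2) = 0"
    by (simp only: of_real_eq_0_iff)
  then show ?thesis by auto
qed

text \<open>With \<open>x = cis (real a * pi / real M)\<close> the doubled cosine is x + 1/x, and
  the equation becomes the fifth cyclotomic equation for \<open>x\<close>. Thus
  \<open>x ^ 5 = 1\<close>, so \<open>5 * a = 2 * k * M\<close> for some \<open>k\<close>. If 5 did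
  not divide \<open>M\<close>, it would divide \<open>k\<close>, making \<open>a\<close> a multiple
  of \<open>M\<close>.\<close>

lemma golden_cosine_imp_5_dvd:
  assumes "0 < a" "a < M"
    and "(2 * cos (real a * pi / real M))\<^sup>2 + 2 * cos (real a * pi / real M) = 1"
  shows "5 dvd M"
proof -
  define x where "x = cis (real a * pi / real M)"
  define u where "u = 2 * complex_of_real (cos (real a * pi / real M))"
  have "u\<^sup>2 + u = complex_of_real ((2 * cos (real a * pi / real M))\<^sup>2 + 2 * cos (real a * pi / real M))"
    by (simp add: u_def)
  then have u: "u\<^sup>2 + u = 1" by (simp only: assms(3) of_real_1)
  have x: "x\<^sup>2 + 1 = u * x"
  proof -
    have "x * (x + cnj x) = x * u"
      unfolding complex_add_cnj by (simp add: x_def u_def)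
    moreover have "x * cnj x = 1"
      unfolding x_def by (rule mult_cnj_eq_1) simp
    ultimately show ?thesis by (simp add: power2_eq_square algebra_simps)
  qed
  have "x ^ 4 + x ^ 3 + x\<^sup>2 + x + 1 = (x\<^sup>2 + 1)\<^sup>2 + (x\<^sup>2 + 1) * x - x\<^sup>2"
    by (simp add: algebra_simps power2_eq_square power3_eq_cube power4_eq_xxxx)
  also have "\<dots> = x\<^sup>2 * (u\<^sup>2 + u - 1)"
    unfolding x by (simp add: algebra_simps power2_eq_square)
  also have "\<dots> = 0" using u by simp
  finally have "(x - 1) * (x ^ 4 + x ^ 3 + x\<^sup>2 + x + 1) = 0" by simp
  then have "x ^ 5 = 1"
    by (simp add: algebra_simps eval_nat_numeral)
  then have "Re (cis (5 * (real a * pi / real M))) = 1"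
    by (simp add: x_def Complex.DeMoivre)
  then obtain k :: int where "5 * (real a * pi / real M) = of_int k * 2 * pi"
    using cos_one_2pi_int by auto
  then have "(5 * real a) * pi = (2 * of_int k * real M) * pi"
    using assms(1,2) by (simp add: field_simps)
  then have "real_of_int (5 * int a) = real_of_int (2 * k * int M)"
    by (simp only: mult_right_cancel[OF pi_neq_zero]) simp
  then have k: "5 * int a = 2 * k * int M"
    by (simp only: of_int_eq_iff)
  show ?thesis
  proof (rule ccontr)
    assume "\<not> 5 dvd M"
    then have "\<not> 5 dvd int M" by presburger
    moreover have "5 dvd 2 * (k * int M)"
      using k by (metis dvd_triv_left mult.assoc)
    moreover have "prime (5 :: int)" by simp
    ultimately have "5 dvd k"
      by (simp add: prime_dvd_mult_iff)
    then obtain l where "k = 5 * l" ..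
    with k have l: "int a = 2 * l * int M" by simp
    then have "0 < l" using assms(1) by (smt (verit) mult_nonpos_nonneg of_nat_0_le_iff of_nat_0_less_iff)
    then have "int M \<le> 2 * l * int M" by (simp add: mult_le_cancel_right1)
    then show False unfolding l[symmetric] using assms(1,2) by simp
  qed
qed

text \<open>After multiplication by \<open>sin (pi / 5)\<close> the product-to-sum formulas cancel
  the terms \<open>sin (3 * pi / 5)\<close>.\<close>

lemma cosine_fifth_sum: "2 * cos (2 * pi / 5) + 2 * cos (4 * pi / 5) = -1"
proof -
  have s: "sin (pi / 5) \<noteq> 0"
    using sin_gt_zero[of "pi / 5"] by simp
  have "2 * sin (pi / 5) * cos (2 * pi / 5) = sin (pi / 5 + 2 * pi / 5) + sin (pi / 5 - 2 * pi / 5)"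
    unfolding sin_add sin_diff by simp
  moreover have "2 * sin (pi / 5) * cos (4 * pi / 5) = sin (pi / 5 + 4 * pi / 5) + sin (pi / 5 - 4 * pi / 5)"
    unfolding sin_add sin_diff by simp
  moreover have "pi / 5 + 2 * pi / 5 = 3 * pi / 5" "pi / 5 - 2 * pi / 5 = - (pi / 5)"
    "pi / 5 + 4 * pi / 5 = pi" "pi / 5 - 4 * pi / 5 = - (3 * pi / 5)" by simp_all
  ultimately have "sin (pi / 5) * (2 * cos (2 * pi / 5) + 2 * cos (4 * pi / 5)) = sin (pi / 5) * (-1)"
    by (simp add: algebra_simps)
  then show ?thesis using s by (metis mult_left_cancel)
qed

text \<open>Injectivity of cosine on [0, pi] forces the angles \<open>pi / 2\<close> and
  \<open>2 * pi / 3\<close>.\<close>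

lemma cosine_pair_zero_case:
  assumes "0 < a" "a < M" "0 < b" "b < N"
    and "cos (real a * pi / real M) = 0" "cos (real b * pi / real N) = - 1 / 2"
  shows "even M \<and> 3 dvd N"
proof -
  have "cos (real a * pi / real M) = cos (pi / 2)"
    using assms by simp
  then have "real a * pi / real M = pi / 2"
    by (rule cos_inj_pi[rotated 4]) (use assms in \<open>auto simp: field_simps\<close>)
  then have "real M = 2 * real a"
    using assms by (simp add: field_simps)
  then have 1: "M = 2 * a" by linarith
  have "cos (real b * pi / real N) = cos (2 * pi / 3)"
    using assms cos_120 by simp
  then have "real b * pi / real N = 2 * pi / 3"
    by (rule cos_inj_pi[rotated 4]) (use assms in \<open>auto simp: field_simps\<close>)
  then have "3 * real b = 2 * real N"
    using assms by (simp add: field_simps)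
  then have "3 * b = 2 * N" by linarith
  then have "3 dvd N" by presburger
  with 1 show ?thesis by simp
qed

lemma cosine_pair_iff:
  assumes "M > 0" "N > 0"
  shows "(\<exists>a b. 0 < a \<and> a < M \<and> 0 < b \<and> b < N \<and>
      2 * cos (real a * pi / real M) + 2 * cos (real b * pi / real N) = -1) \<longleftrightarrow>
    (3 dvd M \<and> even N) \<or> (even M \<and> 3 dvd N) \<or> (5 dvd M \<and> 5 dvd N)"
    (is "?L \<longleftrightarrow> ?R")
proof
  assume ?L
  then obtain a b where ab: "0 < a" "a < M" "0 < b" "b < N"
    and sum: "2 * cos (real a * pi / real M) + 2 * cos (real b * pi / real N) = -1"
    by blast
  define u where "u = 2 * cos (real a * pi / real M)"
  define v where "v = 2 * cos (real b * pi / real N)"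
  have v: "v = -1 - u" using sum by (simp add: u_def v_def)
  \<comment> \<open>Strictness, from \<open>a < M\<close> and \<open>b < N\<close>, later excludes
    the pair of values 1 and -2.\<close>
  have bounds: "-2 < u" "-2 < v"
  proof -
    have "cos pi < cos (real a * pi / real M)" "cos pi < cos (real b * pi / real N)"
      using ab by (auto intro!: cos_monotone_0_pi simp: field_simps simp del: cos_pi)
    then show "-2 < u" "-2 < v" by (simp_all add: u_def v_def)
  qed
  have "u * v = 0 \<or> u * v = -1 \<or> u * v = -2"
    using root_of_unity_cosine_product[OF assms sum] by (simp add: u_def v_def)
  then consider "u = 0" | "v = 0" | "u * v = -1" | "u * v = -2" by auto
  then show ?R
  proof cases
    case 1
    then show ?thesis
      using cosine_pair_zero_case[OF ab] v by (simp add: u_def v_def)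
  next
    case 2
    then show ?thesis
      using cosine_pair_zero_case[OF ab(3,4,1,2)] v by (simp add: u_def v_def)
  next
    \<comment> \<open>Sum and product are both -1, so \<open>u\<close> and \<open>v\<close> are the
      roots of X^2 + X - 1.\<close>
    case 3
    then have "u\<^sup>2 + u = 1" "v\<^sup>2 + v = 1"
      by (simp_all add: v power2_eq_square algebra_simps)
    then show ?thesis
      using golden_cosine_imp_5_dvd ab by (simp add: u_def v_def)
  next
    case 4
    then have "(u - 1) * (u + 2) = 0" by (simp add: v algebra_simps)
    then show ?thesis using bounds v by auto
  qed
next
  assume ?R
  \<comment> \<open>The witnesses give the angles \<open>2 * pi / 3\<close> and
    \<open>pi / 2\<close> in the first two cases, \<open>2 * pi / 5\<close> and
    \<open>4 * pi / 5\<close> in the third.\<close>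
  then consider "3 dvd M" "even N" | "even M" "3 dvd N" | "5 dvd M" "5 dvd N" by blast
  then show ?L
  proof cases
    case 1
    then obtain a b where ab: "M = 3 * a" "N = 2 * b" by (auto elim!: dvdE)
    have "real (2 * a) * pi / real M = 2 * pi / 3" "real b * pi / real N = pi / 2"
      using ab assms by simp_all
    then show ?thesis
      using ab assms cos_120 by (intro exI[of _ "2 * a"] exI[of _ b]) simp
  next
    case 2
    then obtain a b where ab: "M = 2 * a" "N = 3 * b" by (auto elim!: dvdE)
    have "real a * pi / real M = pi / 2" "real (2 * b) * pi / real N = 2 * pi / 3"
      using ab assms by simp_all
    then show ?thesis
      using ab assms cos_120 by (intro exI[of _ a] exI[of _ "2 * b"]) simp
  next
    case 3
    then obtain a b where ab: "M = 5 * a" "N = 5 * b" by (auto elim!: dvdE)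
    have "real (2 * a) * pi / real M = 2 * pi / 5" "real (4 * b) * pi / real N = 4 * pi / 5"
      using ab assms by simp_all
    then show ?thesis
      using ab assms cosine_fifth_sum by (intro exI[of _ "2 * a"] exI[of _ "4 * b"]) simp
  qed
qed

section \<open>Kronecker products\<close>

lemma sum_div_mod:
  fixes f :: "nat \<Rightarrow> nat \<Rightarrow> 'a::comm_monoid_add"
  shows "(\<Sum>k<m * n. f (k div n) (k mod n)) = (\<Sum>i<m. \<Sum>j<n. f i j)"
proof (cases "n = 0")
  case False
  have "(\<Sum>k<m * n. f (k div n) (k mod n)) = (\<Sum>(i, j)\<in>{..<m} \<times> {..<n}. f i j)"
  proof (rule sum.reindex_bij_witness[of _ "\<lambda>(i, j). i * n + j" "\<lambda>k. (k div n, k mod n)"])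
    show "(case p of (i, j) \<Rightarrow> i * n + j) \<in> {..<m * n}" if p: "p \<in> {..<m} \<times> {..<n}" for p
    proof -
      obtain i j where ij: "p = (i, j)" "i < m" "j < n" using p by auto
      then have "i * n + j < Suc i * n" by simp
      also have "\<dots> \<le> m * n" using ij by (intro mult_le_mono1) simp
      finally show ?thesis using ij by simp
    qed
  qed (use False in \<open>auto simp: less_mult_imp_div_less\<close>)
  then show ?thesis by (simp add: sum.cartesian_product)
qed simp

lemma kronecker_carrier [simp]:
  "A \<in> carrier_mat p q \<Longrightarrow> B \<in> carrier_mat r s \<Longrightarrow> kronecker A B \<in> carrier_mat (p * r) (q * s)"
  by (auto simp: kronecker_def)

text \<open>The mixed-product property: by \<open>sum_div_mod\<close> the sum over the composite
  index becomes a double sum, which factors.\<close>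

lemma kronecker_mult_kronecker:
  assumes A: "A \<in> carrier_mat p m" and B: "B \<in> carrier_mat q n"
    and C: "C \<in> carrier_mat m r" and D: "D \<in> carrier_mat n s"
  shows "kronecker A B * kronecker C D = kronecker (A * C) (B * D)"
proof (rule eq_matI)
  fix i j
  assume "i < dim_row (kronecker (A * C) (B * D))" "j < dim_col (kronecker (A * C) (B * D))"
  then have ij: "i < p * q" "j < r * s"
    using assms by (auto simp: kronecker_def)
  then have "q > 0" "s > 0" by (auto intro: Nat.gr0I)
  then have lt: "i div q < p" "i mod q < q" "j div s < r" "j mod s < s"
    using ij by (auto simp: less_mult_imp_div_less)
  define f where "f k l = A $$ (i div q, k) * B $$ (i mod q, l) * (C $$ (k, j div s) * D $$ (l, j mod s))" for k l
  have "(kronecker A B * kronecker C D) $$ (i, j) = (\<Sum>k<m * n. f (k div n) (k mod n))"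
    using assms ij by (simp add: kronecker_def scalar_prod_def f_def lessThan_atLeast0)
  also have "\<dots> = (\<Sum>k<m. \<Sum>l<n. f k l)"
    by (rule sum_div_mod)
  also have "\<dots> = (\<Sum>k<m. A $$ (i div q, k) * C $$ (k, j div s)) *
      (\<Sum>l<n. B $$ (i mod q, l) * D $$ (l, j mod s))"
    by (simp add: sum_product f_def mult_ac)
  also have "\<dots> = kronecker (A * C) (B * D) $$ (i, j)"
    using assms ij lt by (simp add: kronecker_def scalar_prod_def lessThan_atLeast0)
  finally show "(kronecker A B * kronecker C D) $$ (i, j) = kronecker (A * C) (B * D) $$ (i, j)" .
qed (use assms in \<open>auto simp: kronecker_def\<close>)

section \<open>Diagonalisation of \<open>T_mat\<close> by sines\<close>

text \<open>The matrix of the discrete sine transform; \<open>Suc\<close> converts indices from 0 to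
  the usual ones from 1.\<close>

definition sine_mat :: "nat \<Rightarrow> real mat" where
  "sine_mat n = mat n n (\<lambda>(i, j). sin (real (Suc i * Suc j) * pi / real (Suc n)))"

definition T_eigenvalue :: "nat \<Rightarrow> nat \<Rightarrow> real" where
  "T_eigenvalue n j = 1 + 2 * cos (real (Suc j) * pi / real (Suc n))"

definition T_eigen_mat :: "nat \<Rightarrow> real mat" where
  "T_eigen_mat n = mat n n (\<lambda>(i, j). if i = j then T_eigenvalue n j else 0)"

lemma carrier_mats [simp]:
  "T_mat n \<in> carrier_mat n n" "sine_mat n \<in> carrier_mat n n" "T_eigen_mat n \<in> carrier_mat n n"
  by (simp_all add: T_mat_def sine_mat_def T_eigen_mat_def)

text \<open>The addition formulas turn the sum of the two neighbours of a sine entry into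
  \<open>2 * cos \<theta>\<close> times that entry.\<close>

lemma T_mat_mult_sine_mat: "T_mat n * sine_mat n = sine_mat n * T_eigen_mat n"
proof (rule eq_matI)
  fix i j
  assume "i < dim_row (sine_mat n * T_eigen_mat n)" "j < dim_col (sine_mat n * T_eigen_mat n)"
  then have ij: "i < n" "j < n" by (auto simp: sine_mat_def T_eigen_mat_def)
  define \<theta> where "\<theta> = real (Suc j) * pi / real (Suc n)"
  define s where "s k = sin (real k * \<theta>)" for k
  have S: "sine_mat n $$ (k, j) = s (Suc k)" if "k < n" for k
    using that ij unfolding sine_mat_def s_def \<theta>_def
    by (simp only: index_mat prod.case of_nat_mult mult.assoc times_divide_eq_right)
  have "real (Suc n) * \<theta> = real (Suc j) * pi" by (simp add: \<theta>_def)
  \<comment> \<open>These zeros stand for the neighbours missing in the first and last rows.\<close>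
  then have s_end: "s 0 = 0" "s (Suc n) = 0"
    unfolding s_def by (simp_all only: sin_npi) simp
  have "(T_mat n * sine_mat n) $$ (i, j) =
      (\<Sum>k<n. (if k = i then s (Suc k) else 0) + (if k = Suc i then s (Suc k) else 0)
        + (if Suc k = i then s (Suc k) else 0))"
  proof -
    have "(T_mat n * sine_mat n) $$ (i, j) = (\<Sum>k<n. T_mat n $$ (i, k) * sine_mat n $$ (k, j))"
      using ij carrier_matD[OF carrier_mats(1)] carrier_matD[OF carrier_mats(2)]
      by (simp add: scalar_prod_def lessThan_atLeast0)
    also have "\<dots> = (\<Sum>k<n. (if k = i then s (Suc k) else 0) + (if k = Suc i then s (Suc k) else 0)
        + (if Suc k = i then s (Suc k) else 0))"
      by (rule sum.cong) (use ij in \<open>auto simp: S T_mat_def\<close>)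
    finally show ?thesis .
  qed
  also have "\<dots> = s (Suc i) + s (Suc (Suc i)) + s i"
  proof -
    have "(\<Sum>k<n. if k = i then s (Suc k) else 0) = s (Suc i)"
      using ij by simp
    moreover have "(\<Sum>k<n. if k = Suc i then s (Suc k) else 0) = s (Suc (Suc i))"
    proof (cases "Suc i < n")
      case False
      then have "Suc i = n" using ij by simp
      then show ?thesis using s_end by simp
    qed simp
    moreover have "(\<Sum>k<n. if Suc k = i then s (Suc k) else 0) = s i"
      using ij s_end by (cases i) simp_all
    ultimately show ?thesis by (simp add: sum.distrib)
  qed
  also have "s (Suc (Suc i)) = sin (real (Suc i) * \<theta> + \<theta>)"
    by (simp add: s_def algebra_simps)
  also have "s i = sin (real (Suc i) * \<theta> - \<theta>)"
    by (simp add: s_def algebra_simps)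
  also have "s (Suc i) + sin (real (Suc i) * \<theta> + \<theta>) + sin (real (Suc i) * \<theta> - \<theta>)
      = s (Suc i) * T_eigenvalue n j"
    unfolding sin_add sin_diff by (simp add: s_def T_eigenvalue_def \<theta>_def algebra_simps)
  also have "\<dots> = (\<Sum>k<n. if k = j then sine_mat n $$ (i, k) * T_eigenvalue n k else 0)"
    using ij by (simp add: S)
  also have "\<dots> = (sine_mat n * T_eigen_mat n) $$ (i, j)"
  proof -
    have "(sine_mat n * T_eigen_mat n) $$ (i, j) = (\<Sum>k<n. sine_mat n $$ (i, k) * T_eigen_mat n $$ (k, j))"
      using ij carrier_matD[OF carrier_mats(2)] carrier_matD[OF carrier_mats(3)]
      by (simp add: scalar_prod_def lessThan_atLeast0)
    also have "\<dots> = (\<Sum>k<n. if k = j then sine_mat n $$ (i, k) * T_eigenvalue n k else 0)"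
      by (rule sum.cong) (use ij in \<open>auto simp: T_eigen_mat_def\<close>)
    finally show ?thesis by simp
  qed
  finally show "(T_mat n * sine_mat n) $$ (i, j) = (sine_mat n * T_eigen_mat n) $$ (i, j)" .
qed (simp_all add: T_mat_def sine_mat_def T_eigen_mat_def)

text \<open>Multiplication by \<open>2 * sin (\<theta> / 2)\<close> makes the sum telescope;
  \<open>0 < r < 2 * M\<close> keeps this factor nonzero.\<close>

lemma sum_cos_multiples:
  assumes "0 < r" "r < 2 * M"
  shows "(\<Sum>k<M. cos (real k * (real r * pi / real M))) = (1 - (-1) ^ r) / 2"
proof -
  define \<theta> where "\<theta> = real r * pi / real M"
  have "0 < \<theta> / 2" "\<theta> / 2 < pi"
    using assms by (auto simp: \<theta>_def field_simps)
  then have s: "sin (\<theta> / 2) \<noteq> 0"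
    using sin_gt_zero[of "\<theta> / 2"] by simp
  have "2 * sin (\<theta> / 2) * (\<Sum>k<L. cos (real k * \<theta>)) = sin (real L * \<theta> - \<theta> / 2) + sin (\<theta> / 2)" for L
  proof (induction L)
    case (Suc L)
    have "2 * sin (\<theta> / 2) * cos (real L * \<theta>) = sin (real L * \<theta> + \<theta> / 2) - sin (real L * \<theta> - \<theta> / 2)"
      unfolding sin_add sin_diff by simp
    moreover have "real (Suc L) * \<theta> - \<theta> / 2 = real L * \<theta> + \<theta> / 2"
      by (simp add: distrib_right)
    ultimately show ?case
      using Suc by (simp only: sum.lessThan_Suc distrib_left)
  qed simp
  note this[of M]
  also have "real M * \<theta> = real r * pi"
    using assms by (simp add: \<theta>_def)
  also have "sin (real r * pi - \<theta> / 2) + sin (\<theta> / 2) = 2 * sin (\<theta> / 2) * ((1 - (-1) ^ r) / 2)"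
    unfolding sin_diff by (simp add: algebra_simps)
  finally show ?thesis
    using s by (simp add: \<theta>_def)
qed

text \<open>Product-to-sum formulas leave two cosine sums, with parameters \<open>q - p\<close> and
  \<open>q + p\<close> of equal parity. By \<open>sum_cos_multiples\<close> they cancel for
  \<open>p \<noteq> q\<close>; for \<open>p = q\<close> the first is \<open>Suc n\<close> and the
  second is 0.\<close>

lemma sum_sin_mult_sin:
  assumes p: "0 < p" "p \<le> n" and q: "0 < q" "q \<le> n"
  shows "(\<Sum>k<Suc n. sin (real (p * k) * pi / real (Suc n)) * sin (real (k * q) * pi / real (Suc n)))
    = (if p = q then real (Suc n) / 2 else 0)"
proof -
  define C where "C r = (\<Sum>k<Suc n. cos (real k * (real r * pi / real (Suc n))))" for r
  have main: "(\<Sum>k<Suc n. sin (real (p * k) * pi / real (Suc n)) * sin (real (k * q) * pi / real (Suc n)))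
      = (C (q - p) - C (q + p)) / 2" if "p \<le> q" for p q
  proof -
    have "sin (real (p * k) * pi / real (Suc n)) * sin (real (k * q) * pi / real (Suc n)) =
        (cos (real k * (real (q - p) * pi / real (Suc n)))
          - cos (real k * (real (q + p) * pi / real (Suc n)))) / 2" for k
    proof -
      define x y where "x = real (k * q) * pi / real (Suc n)" and "y = real (p * k) * pi / real (Suc n)"
      have "real k * (real (q - p) * pi / real (Suc n)) = x - y"
        "real k * (real (q + p) * pi / real (Suc n)) = x + y"
        using that by (simp_all add: x_def y_def of_nat_diff diff_divide_distrib add_divide_distrib algebra_simps)
      then show ?thesis
        unfolding x_def[symmetric] y_def[symmetric] by (simp add: cos_add cos_diff)
    qed
    then show ?thesis
      unfolding C_def sum_subtractf[symmetric] sum_divide_distrib by (intro sum.cong refl)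
  qed
  have diff: "C (q - p) - C (q + p) = 0" if "0 < p" "p < q" "q \<le> n" for p q
  proof -
    have "C (q - p) = (1 - (-1) ^ (q - p)) / 2" "C (q + p) = (1 - (-1) ^ (q + p)) / 2"
      unfolding C_def using that by (intro sum_cos_multiples; simp)+
    moreover have "(-1) ^ (q - p) = ((-1) ^ (q + p) :: real)"
      using that by (simp add: uminus_power_if)
    ultimately show ?thesis by simp
  qed
  consider "p < q" | "p = q" | "q < p" by linarith
  then show ?thesis
  proof cases
    case 1
    then show ?thesis using main[of p q] diff[of p q] p q by simp
  next
    case 2
    have "C 0 = real (Suc n)" by (simp add: C_def)
    moreover have "C (q + q) = (1 - (-1) ^ (q + q)) / 2"
      unfolding C_def using q by (intro sum_cos_multiples; simp)
    ultimately show ?thesis using main[of p q] 2 by simp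
  next
    case 3
    have "(\<Sum>k<Suc n. sin (real (p * k) * pi / real (Suc n)) * sin (real (k * q) * pi / real (Suc n))) =
        (\<Sum>k<Suc n. sin (real (q * k) * pi / real (Suc n)) * sin (real (k * p) * pi / real (Suc n)))"
      by (simp add: mult.commute)
    then show ?thesis using main[of q p] diff[of q p] p q 3 by simp
  qed
qed

text \<open>Orthogonality of the sine vectors; it makes \<open>sine_mat\<close> invertible.\<close>

lemma sine_mat_square: "sine_mat n * sine_mat n = (real (Suc n) / 2) \<cdot>\<^sub>m 1\<^sub>m n"
proof (rule eq_matI)
  fix i j
  assume "i < dim_row ((real (Suc n) / 2) \<cdot>\<^sub>m 1\<^sub>m n)" "j < dim_col ((real (Suc n) / 2) \<cdot>\<^sub>m 1\<^sub>m n)"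
  then have ij: "i < n" "j < n" by auto
  have "(sine_mat n * sine_mat n) $$ (i, j) =
      (\<Sum>k<n. sin (real (Suc i * Suc k) * pi / real (Suc n)) * sin (real (Suc k * Suc j) * pi / real (Suc n)))"
    using ij unfolding sine_mat_def
    by (simp add: scalar_prod_def lessThan_atLeast0 del: mult_Suc mult_Suc_right of_nat_Suc)
  \<comment> \<open>The added term \<open>k = 0\<close> is zero, so the sum can run over a full
    period of \<open>Suc n\<close> indices.\<close>
  also have "\<dots> = (\<Sum>k<Suc n. sin (real (Suc i * k) * pi / real (Suc n)) * sin (real (k * Suc j) * pi / real (Suc n)))"
    by (subst sum.lessThan_Suc_shift) simp
  also have "\<dots> = (if i = j then real (Suc n) / 2 else 0)"
    by (subst sum_sin_mult_sin) (use ij in auto)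
  finally show "(sine_mat n * sine_mat n) $$ (i, j) = ((real (Suc n) / 2) \<cdot>\<^sub>m 1\<^sub>m n) $$ (i, j)"
    using ij by simp
qed (simp_all add: sine_mat_def)

section \<open>The determinant of A(m, n)\<close>

lemma kronecker_smult_one:
  "kronecker (a \<cdot>\<^sub>m 1\<^sub>m m) (b \<cdot>\<^sub>m 1\<^sub>m n) = (a * b) \<cdot>\<^sub>m 1\<^sub>m (m * n)"
proof (rule eq_matI)
  fix i j
  assume "i < dim_row ((a * b) \<cdot>\<^sub>m 1\<^sub>m (m * n))" "j < dim_col ((a * b) \<cdot>\<^sub>m 1\<^sub>m (m * n))"
  then have ij: "i < m * n" "j < m * n" by auto
  then have "n > 0" by (auto intro: Nat.gr0I)
  moreover have "i = j \<longleftrightarrow> i div n = j div n \<and> i mod n = j mod n"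
    by (metis div_mult_mod_eq)
  ultimately show "kronecker (a \<cdot>\<^sub>m 1\<^sub>m m) (b \<cdot>\<^sub>m 1\<^sub>m n) $$ (i, j) = ((a * b) \<cdot>\<^sub>m 1\<^sub>m (m * n)) $$ (i, j)"
    using ij by (simp add: kronecker_def less_mult_imp_div_less)
qed (simp_all add: kronecker_def)

text \<open>\<open>V\<close> intertwines the matrix with the diagonal matrix \<open>D\<close>, and
  \<open>V * V\<close> is a nonzero multiple of the identity. Hence \<open>det V\<close> cancels and
  the determinant equals \<open>det D\<close>.\<close>

lemma det_lights_out_mat_eq_0_iff:
  "det (lights_out_mat m n) = 0 \<longleftrightarrow>
    (\<exists>j<m. \<exists>k<n. T_eigenvalue m j + T_eigenvalue n k = 1)"
proof -
  define V where "V = kronecker (sine_mat m) (sine_mat n)"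
  define E1 where "E1 = kronecker (1\<^sub>m m) (T_eigen_mat n)"
  define E2 where "E2 = kronecker (T_eigen_mat m) (1\<^sub>m n)"
  define K1 where "K1 = kronecker (1\<^sub>m m) (T_mat n)"
  define K2 where "K2 = kronecker (T_mat m) (1\<^sub>m n)"
  define D where "D = E1 + E2 - 1\<^sub>m (m * n)"
  have c: "V \<in> carrier_mat (m * n) (m * n)" "E1 \<in> carrier_mat (m * n) (m * n)"
    "E2 \<in> carrier_mat (m * n) (m * n)" "K1 \<in> carrier_mat (m * n) (m * n)"
    "K2 \<in> carrier_mat (m * n) (m * n)" "D \<in> carrier_mat (m * n) (m * n)"
    by (auto simp: V_def E1_def E2_def K1_def K2_def D_def)
  have A: "lights_out_mat m n = K1 + K2 - 1\<^sub>m (m * n)"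
    by (simp add: lights_out_mat_kronecker K1_def K2_def)
  have cA: "lights_out_mat m n \<in> carrier_mat (m * n) (m * n)"
    by (simp add: lights_out_mat_def)
  have one: "1\<^sub>m k * sine_mat k = sine_mat k * 1\<^sub>m k" for k
    by (simp add: left_mult_one_mat[of _ k k] right_mult_one_mat[of _ k k])
  have 1: "K1 * V = V * E1"
    unfolding K1_def V_def E1_def
    by (simp add: kronecker_mult_kronecker[of _ m m _ n n _ m _ n] T_mat_mult_sine_mat one)
  have 2: "K2 * V = V * E2"
    unfolding K2_def V_def E2_def
    by (simp add: kronecker_mult_kronecker[of _ m m _ n n _ m _ n] T_mat_mult_sine_mat one)
  have "lights_out_mat m n * V = K1 * V + K2 * V - 1\<^sub>m (m * n) * V"
    unfolding A using c by (simp add: minus_mult_distrib_mat[of _ "m * n" "m * n"]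
        add_mult_distrib_mat[of _ "m * n" "m * n"])
  also have "\<dots> = V * D"
    unfolding D_def 1 2 using c
    by (simp add: mult_minus_distrib_mat[OF c(1) add_carrier_mat[OF c(3)] one_carrier_mat]
        mult_add_distrib_mat[OF c(1-3)])
  finally have eq: "lights_out_mat m n * V = V * D" .
  have "V * V = kronecker (sine_mat m * sine_mat m) (sine_mat n * sine_mat n)"
    unfolding V_def by (rule kronecker_mult_kronecker[of _ m m _ n n _ m _ n]) simp_all
  then have "V * V = (real (Suc m) / 2 * (real (Suc n) / 2)) \<cdot>\<^sub>m 1\<^sub>m (m * n)"
    by (simp only: sine_mat_square kronecker_smult_one)
  then have "det V * det V = (real (Suc m) / 2 * (real (Suc n) / 2)) ^ (m * n)"
    using det_mult[OF c(1) c(1)] by (simp add: det_smult)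
  then have "det V \<noteq> 0" by (metis mult_zero_left power_not_zero mult_eq_0_iff divide_eq_0_iff
        of_nat_eq_0_iff nat.distinct(2) zero_neq_numeral)
  moreover have "det (lights_out_mat m n) * det V = det V * det D"
    using det_mult[OF cA c(1)] det_mult[OF c(1) c(6)] by (simp only: eq)
  ultimately have det_eq: "det (lights_out_mat m n) = det D" by simp
  have D_entry: "D $$ (i, j) = (if i = j then T_eigenvalue n (i mod n) + T_eigenvalue m (i div n) - 1 else 0)"
    if "i < m * n" "j < m * n" for i j
  proof -
    have "n > 0" using that by (auto intro: Nat.gr0I)
    moreover have "i = j \<longleftrightarrow> i div n = j div n \<and> i mod n = j mod n"
      by (metis div_mult_mod_eq)
    ultimately show ?thesis
      using that by (auto simp: D_def E1_def E2_def kronecker_def T_eigen_mat_def less_mult_imp_div_less)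
  qed
  have "upper_triangular D"
    unfolding upper_triangular_def using c D_entry by auto
  then have "det D = 0 \<longleftrightarrow> (\<exists>i<m * n. D $$ (i, i) = 0)"
    using upper_triangular_imp_det_eq_0_iff[OF c(6)] c by (auto simp: diag_mat_def)
  also have "\<dots> \<longleftrightarrow> (\<exists>i<m * n. T_eigenvalue n (i mod n) + T_eigenvalue m (i div n) = 1)"
    by (auto simp: D_entry)
  also have "\<dots> \<longleftrightarrow> (\<exists>j<m. \<exists>k<n. T_eigenvalue m j + T_eigenvalue n k = 1)"
  proof
    assume "\<exists>i<m * n. T_eigenvalue n (i mod n) + T_eigenvalue m (i div n) = 1"
    then obtain i where i: "i < m * n" "T_eigenvalue n (i mod n) + T_eigenvalue m (i div n) = 1"
      by blast
    moreover have "i div n < m" using i by (simp add: less_mult_imp_div_less)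
    moreover have "n > 0" using i by (auto intro: Nat.gr0I)
    then have "i mod n < n" by simp
    ultimately show "\<exists>j<m. \<exists>k<n. T_eigenvalue m j + T_eigenvalue n k = 1"
      by (metis add.commute)
  next
    assume "\<exists>j<m. \<exists>k<n. T_eigenvalue m j + T_eigenvalue n k = 1"
    then obtain j k where jk: "j < m" "k < n" "T_eigenvalue m j + T_eigenvalue n k = 1" by blast
    have "j * n + k < Suc j * n" using jk by simp
    also have "\<dots> \<le> m * n" using jk by (intro mult_le_mono1) simp
    finally show "\<exists>i<m * n. T_eigenvalue n (i mod n) + T_eigenvalue m (i div n) = 1"
      using jk by (intro exI[of _ "j * n + k"]) (simp add: add.commute)
  qed
  finally show ?thesis unfolding det_eq .
qed

theorem mainTheorem1:
  fixes m n :: nat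
  assumes "m \<ge> 1" and "n \<ge> 1"
  shows "det (lights_out_mat m n) = 0 \<longleftrightarrow>
      (m mod 3 = 2 \<and> odd n) \<or>
      (odd m \<and> n mod 3 = 2) \<or>
      (m mod 5 = 4 \<and> n mod 5 = 4)"
proof -
  let ?c = "\<lambda>a b. 2 * cos (real a * pi / real (Suc m)) + 2 * cos (real b * pi / real (Suc n)) = -1"
  \<comment> \<open>Each \<open>T_eigenvalue\<close> contains a summand 1, so a sum equal to 1 means
    that the doubled cosines add up to -1.\<close>
  have "det (lights_out_mat m n) = 0 \<longleftrightarrow> (\<exists>j<m. \<exists>k<n. ?c (Suc j) (Suc k))"
    unfolding det_lights_out_mat_eq_0_iff T_eigenvalue_def
    by (intro ex_cong1 conj_cong refl) argo
  also have "\<dots> \<longleftrightarrow> (\<exists>a b. 0 < a \<and> a < Suc m \<and> 0 < b \<and> b < Suc n \<and> ?c a b)"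
    by (metis Suc_less_eq Suc_pred zero_less_Suc)
  also have "\<dots> \<longleftrightarrow> (3 dvd Suc m \<and> even (Suc n)) \<or> (even (Suc m) \<and> 3 dvd Suc n) \<or> (5 dvd Suc m \<and> 5 dvd Suc n)"
    by (rule cosine_pair_iff) simp_all
  also have "3 dvd Suc m \<longleftrightarrow> m mod 3 = 2" by presburger
  also have "3 dvd Suc n \<longleftrightarrow> n mod 3 = 2" by presburger
  also have "5 dvd Suc m \<longleftrightarrow> m mod 5 = 4" by presburger
  also have "5 dvd Suc n \<longleftrightarrow> n mod 5 = 4" by presburger
  finally show ?thesis by simp
qed

end
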